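(* Let $n\ge1$, $R>0$, and let $\rho_l,\rho_r>0$ and $u_l>u_r$ be real constants. Consider the system $$\partial_t\rho+\partial_r(\rho u)+\tfrac{n-1}{r}\rho u=0,\qquad \partial_t(\rho u)+\partial_r(\rho u^2)+\tfrac{n-1}{r}\rho u^2=0$$ with pseudo-Riemann initial data $$(\rho,u)|_{t=0}=\begin{cases}(\rho_l r^{1-n},u_l), & r<R,\\ (\rho_r r^{1-n},u_r), & r>R.\end{cases}$$ Then this problem has at most one physical and dissipative local shadow wave solution, locally near $r=R$ and for sufficiently small time; that is, for any two physical and dissipative local shadow wave solutions with these initial data there are $\delta>0$ and $T_0>0$ such that they coincide (same front $c$, same mass $\sigma$, same outer states) for $|r-R|<\delta$ and $0\le t<T_0$.
   Context: Jump notation: $[f]=f_1-f_0$, with $f_0,f_1$ formed from $(\rho_0,u_0)$, $(\rho_1,u_1)$ and evaluated at $(R+c(t),t)$. Set $\kappa_1=\dot c[\rho]-[\rho u]$ and $\kappa_2=\dot c[\rho u]-[\rho u^2]$. A local shadow wave solution on $[0,T)$ with front $r=R+c(t)>0$, $c(0)=0$, is a family, indexed by $\varepsilon>0$, $(\rho^\varepsilon_{sw},u^\varepsilon_{sw})$ equal to $(\rho_0,u_0)$ for $r<R+c(t)-\varepsilon/2$, to $(\sigma(t)/\varepsilon,\,v(t))$ for $|r-R-c(t)|<\varepsilon/2$, and to $(\rho_1,u_1)$ for $r>R+c(t)+\varepsilon/2$, where $\sigma,v\in C^1([0,T))$, $(\rho_0,u_0)$ is $C^1$ on $\{0<r\le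 R+c(t),\ 0\le t<T\}$, $(\rho_1,u_1)$ is $C^1$ on $\{r\ge R+c(t),\ 0\le t<T\}$, they solve the system in the interiors of these regions, $v\equiv\dot c$, and $$\partial_t\sigma+\tfrac{n-1}{R+c(t)}\sigma v=\kappa_1,\qquad \partial_t(\sigma v)+\tfrac{n-1}{R+c(t)}\sigma v^2=\kappa_2 .$$ Having the given (locally integrable) initial data means that $(\rho_0,u_0)$, $(\rho_1,u_1)$ take those data at $t=0$ and that $\sigma(0)=0$ (no initial concentration of mass). The solution is physical if $\sigma(t)\ge0$ on $[0,T)$. It is dissipative if $$\lim_{\varepsilon\to0}\Big(\partial_t\big(\tfrac12\rho^\varepsilon_{sw}(u^\varepsilon_{sw})^2\big)+\partial_r\big(\tfrac12\rho^\varepsilon_{sw}(u^\varepsilon_{sw})^3\big)+\tfrac{n-1}{2r}\rho^\varepsilon_{sw}(u^\varepsilon_{sw})^3\Big)\le0$$ when applied to nonnegative test functions $\phi\in C_c^\infty(\,]0,\infty[\times]0,T[\,)$. *)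

theory Defs
  imports "HOL-Analysis.Analysis"
begin

text \<open>
  Functions of the radius \<open>r\<close> and the time \<open>t\<close> are functions on pairs \<open>(r, t)\<close>.

  \<open>C1_on\<close> uses derivatives relative to \<open>S\<close>, so that they are one-sided at those boundary points
  that belong to \<open>S\<close> (\<open>t = 0\<close>, or the front).  On all sets used here they are unique.
  (The library's \<open>C1_differentiable_on\<close> would require two-sided derivatives.)
\<close>

definition C1_on :: "('a::real_normed_vector \<Rightarrow> 'b::real_normed_vector) \<Rightarrow> 'a set \<Rightarrow> bool" where
  "C1_on f S \<longleftrightarrow>
     (\<exists>D :: 'a \<Rightarrow> 'a \<Rightarrow>\<^sub>L 'b.
        (\<forall>x\<in>S. (f has_derivative blinfun_apply (D x)) (at x within S)) \<and> continuous_on S D)"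

definition partial_r :: "(real \<times> real \<Rightarrow> real) \<Rightarrow> real \<times> real \<Rightarrow> real" where
  "partial_r f = (\<lambda>(r, t). deriv (\<lambda>x. f (x, t)) r)"

definition partial_t :: "(real \<times> real \<Rightarrow> real) \<Rightarrow> real \<times> real \<Rightarrow> real" where
  "partial_t f = (\<lambda>(r, t). deriv (\<lambda>s. f (r, s)) t)"

definition solves_system ::
    "nat \<Rightarrow> (real \<times> real \<Rightarrow> real) \<Rightarrow> (real \<times> real \<Rightarrow> real) \<Rightarrow> (real \<times> real) set \<Rightarrow> bool" where
  "solves_system n \<rho> u \<Omega> \<longleftrightarrow>
     (\<forall>(r, t) \<in> \<Omega>.
        partial_t \<rho> (r, t) + partial_r (\<lambda>p. \<rho> p * u p) (r, t)
          + (real n - 1) / r * (\<rho> (r, t) * u (r, t)) = 0 \<and>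
        partial_t (\<lambda>p. \<rho> p * u p) (r, t) + partial_r (\<lambda>p. \<rho> p * (u p)\<^sup>2) (r, t)
          + (real n - 1) / r * (\<rho> (r, t) * (u (r, t))\<^sup>2) = 0)"

text \<open>
  The data that determine a shadow wave family on \<open>[0,T)\<close>: \<open>T\<close>, \<open>c\<close>, \<open>\<sigma>\<close>, \<open>v\<close>, \<open>\<rho>\<^sub>0\<close>, \<open>u\<^sub>0\<close>, \<open>\<rho>\<^sub>1\<close>, \<open>u\<^sub>1\<close>.
  The fields are total functions; their values outside \<open>[0,T)\<close>, \<open>left_region\<close> and \<open>right_region\<close>
  carry no meaning.
\<close>

record shadow_wave =
  lifetime :: real
  front :: "real \<Rightarrow> real"
  mass :: "real \<Rightarrow> real"
  speed :: "real \<Rightarrow> real"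
  rho0 :: "real \<times> real \<Rightarrow> real"
  u0 :: "real \<times> real \<Rightarrow> real"
  rho1 :: "real \<times> real \<Rightarrow> real"
  u1 :: "real \<times> real \<Rightarrow> real"

definition left_region :: "real \<Rightarrow> shadow_wave \<Rightarrow> (real \<times> real) set" where
  "left_region R W = {(r, t). 0 < r \<and> r \<le> R + front W t \<and> 0 \<le> t \<and> t < lifetime W}"

definition right_region :: "real \<Rightarrow> shadow_wave \<Rightarrow> (real \<times> real) set" where
  "right_region R W = {(r, t). R + front W t \<le> r \<and> 0 \<le> t \<and> t < lifetime W}"

text \<open>
  The family itself.  The values on the two lines \<open>\<bar>r - R - c t\<bar> = \<epsilon> / 2\<close>, a null set, are
  immaterial and are chosen to be those of the middle state.
\<close>

definition rho_sw :: "real \<Rightarrow> shadow_wave \<Rightarrow> real \<Rightarrow> real \<times> real \<Rightarrow> real" where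
  "rho_sw R W \<epsilon> = (\<lambda>(r, t).
     if r < R + front W t - \<epsilon> / 2 then rho0 W (r, t)
     else if r > R + front W t + \<epsilon> / 2 then rho1 W (r, t)
     else mass W t / \<epsilon>)"

definition u_sw :: "real \<Rightarrow> shadow_wave \<Rightarrow> real \<Rightarrow> real \<times> real \<Rightarrow> real" where
  "u_sw R W \<epsilon> = (\<lambda>(r, t).
     if r < R + front W t - \<epsilon> / 2 then u0 W (r, t)
     else if r > R + front W t + \<epsilon> / 2 then u1 W (r, t)
     else speed W t)"

text \<open>
  \<open>jump R W F t\<close> is \<open>[F(\<rho>,u)] = F(\<rho>\<^sub>1,u\<^sub>1) - F(\<rho>\<^sub>0,u\<^sub>0)\<close> at the front.
\<close>

definition jump :: "real \<Rightarrow> shadow_wave \<Rightarrow> (real \<Rightarrow> real \<Rightarrow> real) \<Rightarrow> real \<Rightarrow> real" where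
  "jump R W F t =
     (let p = (R + front W t, t) in F (rho1 W p) (u1 W p) - F (rho0 W p) (u0 W p))"

definition front_derivative :: "shadow_wave \<Rightarrow> real \<Rightarrow> real" where
  "front_derivative W t = vector_derivative (front W) (at t within {0..<lifetime W})"

definition kappa1 :: "real \<Rightarrow> shadow_wave \<Rightarrow> real \<Rightarrow> real" where
  "kappa1 R W t =
     front_derivative W t * jump R W (\<lambda>\<rho> u. \<rho>) t - jump R W (\<lambda>\<rho> u. \<rho> * u) t"

definition kappa2 :: "real \<Rightarrow> shadow_wave \<Rightarrow> real \<Rightarrow> real" where
  "kappa2 R W t =
     front_derivative W t * jump R W (\<lambda>\<rho> u. \<rho> * u) t - jump R W (\<lambda>\<rho> u. \<rho> * u\<^sup>2) t"

definition local_shadow_wave_solution :: "nat \<Rightarrow> real \<Rightarrow> shadow_wave \<Rightarrow> bool" where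
  "local_shadow_wave_solution n R W \<longleftrightarrow>
     0 < lifetime W \<and>
     front W 0 = 0 \<and>
     (\<forall>t\<in>{0..<lifetime W}. 0 < R + front W t) \<and>
     C1_on (mass W) {0..<lifetime W} \<and>
     C1_on (speed W) {0..<lifetime W} \<and>
     C1_on (rho0 W) (left_region R W) \<and>
     C1_on (u0 W) (left_region R W) \<and>
     C1_on (rho1 W) (right_region R W) \<and>
     C1_on (u1 W) (right_region R W) \<and>
     solves_system n (rho0 W) (u0 W) (interior (left_region R W)) \<and>
     solves_system n (rho1 W) (u1 W) (interior (right_region R W)) \<and>
     (\<forall>t\<in>{0..<lifetime W}.
        (front W has_real_derivative speed W t) (at t within {0..<lifetime W})) \<and>
     (\<forall>t\<in>{0..<lifetime W}.
        vector_derivative (mass W) (at t within {0..<lifetime W})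
          + (real n - 1) / (R + front W t) * (mass W t * speed W t) = kappa1 R W t \<and>
        vector_derivative (\<lambda>s. mass W s * speed W s) (at t within {0..<lifetime W})
          + (real n - 1) / (R + front W t) * (mass W t * (speed W t)\<^sup>2) = kappa2 R W t)"

definition pseudo_riemann_data ::
    "nat \<Rightarrow> real \<Rightarrow> real \<Rightarrow> real \<Rightarrow> real \<Rightarrow> real \<Rightarrow> real \<Rightarrow> real \<times> real" where
  "pseudo_riemann_data n R \<rho>l ul \<rho>r ur r =
     (if r < R then (\<rho>l * r powr (1 - real n), ul) else (\<rho>r * r powr (1 - real n), ur))"

text \<open>
  The data are prescribed only for \<open>r \<noteq> R\<close>; at \<open>r = R\<close> the one-sided values of the outer states
  follow by continuity.
\<close>

definition has_initial_data :: "real \<Rightarrow> (real \<Rightarrow> real \<times> real) \<Rightarrow> shadow_wave \<Rightarrow> bool" where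
  "has_initial_data R d W \<longleftrightarrow>
     (\<forall>r. 0 < r \<and> r < R \<longrightarrow> (rho0 W (r, 0), u0 W (r, 0)) = d r) \<and>
     (\<forall>r. R < r \<longrightarrow> (rho1 W (r, 0), u1 W (r, 0)) = d r) \<and>
     mass W 0 = 0"

definition physical :: "shadow_wave \<Rightarrow> bool" where
  "physical W \<longleftrightarrow> (\<forall>t\<in>{0..<lifetime W}. 0 \<le> mass W t)"

text \<open>
  Functions of class \<open>C\<^sup>k\<close> on a whole (finite-dimensional) space: differentiable, with all
  directional derivatives of class \<open>C\<^sup>k\<^sup>-\<^sup>1\<close>.
\<close>

primrec Ck :: "nat \<Rightarrow> ('a::euclidean_space \<Rightarrow> real) \<Rightarrow> bool" where
  "Ck 0 f \<longleftrightarrow> continuous_on UNIV f"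
| "Ck (Suc k) f \<longleftrightarrow>
     f differentiable_on UNIV \<and> (\<forall>h. Ck k (\<lambda>x. frechet_derivative f (at x) h))"

definition test_function :: "('a::euclidean_space) set \<Rightarrow> ('a \<Rightarrow> real) \<Rightarrow> bool" where
  "test_function \<Omega> \<phi> \<longleftrightarrow>
     (\<forall>k. Ck k \<phi>) \<and> compact (closure {x. \<phi> x \<noteq> 0}) \<and> closure {x. \<phi> x \<noteq> 0} \<subseteq> \<Omega>"

text \<open>
  The energy distribution
  \<open>\<partial>\<^sub>t (1/2 \<rho> u\<^sup>2) + \<partial>\<^sub>r (1/2 \<rho> u\<^sup>3) + (n - 1)/(2 r) \<rho> u\<^sup>3\<close> of the \<open>\<epsilon>\<close>-member of the family,
  applied to \<open>\<phi>\<close>; the derivatives act on the test function, with a minus sign.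
\<close>

definition energy_distribution ::
    "nat \<Rightarrow> real \<Rightarrow> shadow_wave \<Rightarrow> real \<Rightarrow> (real \<times> real \<Rightarrow> real) \<Rightarrow> real" where
  "energy_distribution n R W \<epsilon> \<phi> =
     (LINT p : {0<..} \<times> {0<..<lifetime W} | lborel.
        - (1 / 2 * rho_sw R W \<epsilon> p * (u_sw R W \<epsilon> p)\<^sup>2) * partial_t \<phi> p
        - (1 / 2 * rho_sw R W \<epsilon> p * (u_sw R W \<epsilon> p) ^ 3) * partial_r \<phi> p
        + (real n - 1) / (2 * fst p) * (rho_sw R W \<epsilon> p * (u_sw R W \<epsilon> p) ^ 3) * \<phi> p)"

definition dissipative :: "nat \<Rightarrow> real \<Rightarrow> shadow_wave \<Rightarrow> bool" where
  "dissipative n R W \<longleftrightarrow>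
     (\<forall>\<phi>. test_function ({0<..} \<times> {0<..<lifetime W}) \<phi> \<and> (\<forall>p. 0 \<le> \<phi> p) \<longrightarrow>
        (\<exists>L\<le>0. ((\<lambda>\<epsilon>. energy_distribution n R W \<epsilon> \<phi>) \<longlongrightarrow> L) (at_right 0)))"

text \<open>
  Agreement of two shadow waves for \<open>\<bar>r - R\<bar> < \<delta>\<close> and \<open>0 \<le> t < T0\<close>, where both must exist up to
  \<open>T0\<close>.  As the fronts agree, the outer states of both are defined on the same sets.
\<close>

definition coincide :: "real \<Rightarrow> real \<Rightarrow> real \<Rightarrow> shadow_wave \<Rightarrow> shadow_wave \<Rightarrow> bool" where
  "coincide R \<delta> T0 W W' \<longleftrightarrow>
     T0 \<le> lifetime W \<and> T0 \<le> lifetime W' \<and>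
     (\<forall>t\<in>{0..<T0}.
        front W t = front W' t \<and> mass W t = mass W' t \<and> speed W t = speed W' t \<and>
        (\<forall>r. \<bar>r - R\<bar> < \<delta> \<and> 0 < r \<and> r \<le> R + front W t \<longrightarrow>
           rho0 W (r, t) = rho0 W' (r, t) \<and> u0 W (r, t) = u0 W' (r, t)) \<and>
        (\<forall>r. \<bar>r - R\<bar> < \<delta> \<and> R + front W t \<le> r \<longrightarrow>
           rho1 W (r, t) = rho1 W' (r, t) \<and> u1 W (r, t) = u1 W' (r, t)))"

end

theory Submission
  imports Defs
begin

text \<open>
  At \<open>t = 0\<close> the mass and momentum balances at the front give
  \<open>\<rho>\<^sub>r (v - u\<^sub>r)\<^sup>2 = \<rho>\<^sub>l (v - u\<^sub>l)\<^sup>2\<close> for the initial speed \<open>v\<close>, and \<open>\<sigma> \<ge> 0\<close> selects the root with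
  \<open>u\<^sub>r < v < u\<^sub>l\<close>.  For small times the front therefore moves away from the particle paths traced
  backwards in time, and since \<open>\<partial>\<^sub>t u + u \<partial>\<^sub>r u = 0\<close> wherever \<open>\<rho> \<noteq> 0\<close>, the initial data propagate
  along these straight lines: \<open>u\<close> and \<open>\<rho> r\<^sup>n\<^sup>-\<^sup>1\<close> stay constant on either side.  The weighted mass
  \<open>r\<^sup>n\<^sup>-\<^sup>1 \<sigma>\<close> then satisfies balance laws with constant jumps, which integrate explicitly and force
  the front to be a straight line.
\<close>

section \<open>One-sided derivatives in time and partial derivatives\<close>

text \<open>It makes derivatives relative to \<open>{0..<T}\<close> unique, also at the left end 0,
  and allows one-sided limits to be compared there.\<close>

lemma at_within_atLeastLessThan_neq_bot:
  fixes t T :: real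
  assumes "t \<in> {0..<T}"
  shows "at t within {0..<T} \<noteq> bot"
proof -
  have "t islimpt {t<..<T}"
    using assms by (intro islimpt_greaterThanLessThan1) auto
  then have "t islimpt {0..<T}"
    by (rule islimpt_subset) (use assms in auto)
  then show ?thesis
    by (simp add: trivial_limit_within)
qed

lemma C1_on_imp_continuous_on: "C1_on f S \<Longrightarrow> continuous_on S f"
  unfolding C1_on_def continuous_on_eq_continuous_within
  by (meson has_derivative_continuous)

lemma C1_on_has_vector_derivative:
  fixes f :: "real \<Rightarrow> real"
  assumes "C1_on f S" "t \<in> S"
  shows "(f has_vector_derivative vector_derivative f (at t within S)) (at t within S)"
proof -
  have "f differentiable (at t within S)"
    using assms unfolding C1_on_def by (blast intro: differentiableI)
  then show ?thesis
    by (simp add: vector_derivative_works)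
qed

lemma has_derivative_partial_r:
  assumes "(f has_derivative D) (at (r, t))"
  shows "partial_r f (r, t) = D (1, 0)"
proof -
  have "((\<lambda>x. (x, t)) has_derivative (\<lambda>h. (h, 0))) (at r)"
    by (intro has_derivative_Pair has_derivative_ident has_derivative_const)
  from has_derivative_compose[OF this assms]
  have "((\<lambda>x. f (x, t)) has_derivative (\<lambda>h. D (h, 0))) (at r)" .
  moreover have "(\<lambda>h. D (h, 0)) = (*) (D (1, 0))"
  proof
    fix h
    show "D (h, 0) = D (1, 0) * h"
      using linear_scale[OF has_derivative_linear[OF assms], of h "(1,0)"] by (simp add: mult.commute)
  qed
  ultimately have "((\<lambda>x. f (x, t)) has_real_derivative D (1, 0)) (at r)"
    by (simp only: has_field_derivative_def)
  from DERIV_imp_deriv[OF this] show ?thesis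
    by (simp add: partial_r_def)
qed

lemma has_derivative_partial_t:
  assumes "(f has_derivative D) (at (r, t))"
  shows "partial_t f (r, t) = D (0, 1)"
proof -
  have "((\<lambda>x. (r, x)) has_derivative (\<lambda>h. (0, h))) (at t)"
    by (intro has_derivative_Pair has_derivative_ident has_derivative_const)
  from has_derivative_compose[OF this assms]
  have "((\<lambda>x. f (r, x)) has_derivative (\<lambda>h. D (0, h))) (at t)" .
  moreover have "(\<lambda>h. D (0, h)) = (*) (D (0, 1))"
  proof
    fix h
    show "D (0, h) = D (0, 1) * h"
      using linear_scale[OF has_derivative_linear[OF assms], of h "(0,1)"] by (simp add: mult.commute)
  qed
  ultimately have "((\<lambda>x. f (r, x)) has_real_derivative D (0, 1)) (at t)"
    by (simp only: has_field_derivative_def)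
  from DERIV_imp_deriv[OF this] show ?thesis
    by (simp add: partial_t_def)
qed

section \<open>The system in transport form\<close>

text \<open>Momentum balance minus \<open>u\<close> times mass balance leaves \<open>\<rho>\<close>
  times the derivative of \<open>u\<close> in the direction \<open>(u, 1)\<close> of the particle
  path, and \<open>\<rho>\<close> can be cancelled. The second equation is the mass balance with the
  product expanded.\<close>

lemma solves_system_transport:
  assumes "solves_system n \<rho> u \<Omega>" "(r, t) \<in> \<Omega>"
    and \<rho>: "(\<rho> has_derivative D\<rho>) (at (r, t))" and u: "(u has_derivative Du) (at (r, t))"
    and "\<rho> (r, t) \<noteq> 0"
  shows "Du (u (r, t), 1) = 0"
    and "D\<rho> (u (r, t), 1) + \<rho> (r, t) * (Du (1, 0) + (real n - 1) / r * u (r, t)) = 0"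
proof -
  let ?\<rho> = "\<rho> (r, t)" and ?u = "u (r, t)"
  have eq1: "partial_t \<rho> (r, t) + partial_r (\<lambda>p. \<rho> p * u p) (r, t) + (real n - 1) / r * (?\<rho> * ?u) = 0"
    and eq2: "partial_t (\<lambda>p. \<rho> p * u p) (r, t) + partial_r (\<lambda>p. \<rho> p * (u p)\<^sup>2) (r, t)
          + (real n - 1) / r * (?\<rho> * ?u\<^sup>2) = 0"
    using assms(1,2) unfolding solves_system_def by auto
  have \<rho>u: "((\<lambda>p. \<rho> p * u p) has_derivative (\<lambda>h. ?\<rho> * Du h + D\<rho> h * ?u)) (at (r, t))"
    by (rule has_derivative_mult[OF \<rho> u])
  have \<rho>uu: "((\<lambda>p. \<rho> p * (u p)\<^sup>2) has_derivative
      (\<lambda>h. ?\<rho> * (?u * Du h + Du h * ?u) + D\<rho> h * (?u * ?u))) (at (r, t))"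
    using has_derivative_mult[OF \<rho> has_derivative_mult[OF u u]] by (simp add: power2_eq_square)
  have lin: "D (?u, 1) = ?u * D (1, 0) + D (0, 1)" if "(f has_derivative D) (at (r, t))"
    for f D :: "real \<times> real \<Rightarrow> real"
    using linear_add[OF has_derivative_linear[OF that], of "?u *\<^sub>R (1, 0)" "(0, 1)"]
      linear_scale[OF has_derivative_linear[OF that], of ?u "(1, 0)"] by simp
  have e1: "D\<rho> (0, 1) + (?\<rho> * Du (1, 0) + D\<rho> (1, 0) * ?u) + (real n - 1) / r * (?\<rho> * ?u) = 0"
    using eq1 by (simp add: has_derivative_partial_t[OF \<rho>] has_derivative_partial_r[OF \<rho>u])
  have e2: "?\<rho> * Du (0, 1) + D\<rho> (0, 1) * ?u + (?\<rho> * (?u * Du (1, 0) + Du (1, 0) * ?u)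
      + D\<rho> (1, 0) * (?u * ?u)) + (real n - 1) / r * (?\<rho> * (?u * ?u)) = 0"
    using eq2 unfolding has_derivative_partial_t[OF \<rho>u] has_derivative_partial_r[OF \<rho>uu]
    by (simp add: power2_eq_square)
  have "?\<rho> * (?u * Du (1, 0) + Du (0, 1)) = 0"
    using e1 e2 by algebra
  then show "Du (?u, 1) = 0"
    using \<open>?\<rho> \<noteq> 0\<close> lin[OF u] by simp
  show "D\<rho> (?u, 1) + ?\<rho> * (Du (1, 0) + (real n - 1) / r * ?u) = 0"
    using e1 lin[OF \<rho>] by (simp add: algebra_simps)
qed

section \<open>The region on one side of the front\<close>

text \<open>
  The sign \<open>s\<close> selects the side of the front \<open>r = R + c t\<close>: \<open>s = -1\<close> is the left, \<open>s = 1\<close> the right.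
\<close>

definition side_region :: "real \<Rightarrow> real \<Rightarrow> real \<Rightarrow> (real \<Rightarrow> real) \<Rightarrow> (real \<times> real) set" where
  "side_region s R T c = {(r, t). 0 < r \<and> 0 \<le> s * (r - R - c t) \<and> 0 \<le> t \<and> t < T}"

lemma interior_side_region:
  assumes c: "continuous_on {0..<T} c" and "0 < r" "0 < t" "t < T" "0 < s * (r - R - c t)"
  shows "(r, t) \<in> interior (side_region s R T c)"
proof -
  let ?V = "{0<..} \<times> {0<..<T}" and ?f = "\<lambda>p. s * (fst p - R - c (snd p))"
  have "continuous_on ?V (\<lambda>p. c (snd p))"
    by (rule continuous_on_compose2[OF c]) (auto intro: continuous_intros)
  then have "continuous_on ?V ?f"
    by (intro continuous_intros)
  then have "open (?V \<inter> ?f -` {0<..})"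
    by (rule continuous_open_preimage) (auto intro: open_Times)
  moreover have "?V \<inter> ?f -` {0<..} \<subseteq> side_region s R T c"
    by (auto simp: side_region_def)
  moreover have "(r, t) \<in> ?V \<inter> ?f -` {0<..}"
    using assms by auto
  ultimately show ?thesis
    by (meson interiorI)
qed

text \<open>The data are prescribed off \<open>r = R\<close> only. Along the points
  \<open>(R + s * h, 0)\<close> with \<open>h\<close> decreasing to 0, \<open>f\<close> tends to
  \<open>f (R, 0)\<close> by continuity on the region and to \<open>g R\<close> by agreement with
  the data.\<close>

lemma side_region_trace:
  fixes f :: "real \<times> real \<Rightarrow> real"
  assumes "continuous_on (side_region s R T c) f" and "c 0 = 0" "0 < R" "0 < T" "s \<noteq> 0"
    and g: "isCont g R" and fg: "\<And>r. 0 < r \<Longrightarrow> 0 < s * (r - R) \<Longrightarrow> f (r, 0) = g r"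
  shows "f (R, 0) = g R"
proof -
  define X where "X = (\<lambda>h. R + s * h)"
  have X: "(X \<longlongrightarrow> R) (at_right 0)"
    unfolding X_def by (auto intro!: tendsto_eq_intros)
  have "eventually (\<lambda>h::real. 0 < h) (at_right 0)"
    by (simp add: eventually_at_right_less)
  moreover have "eventually (\<lambda>h. 0 < X h) (at_right 0)"
    using order_tendstoD(1)[OF X \<open>0 < R\<close>] .
  ultimately have ev: "eventually (\<lambda>h. (X h, 0) \<in> side_region s R T c \<and> f (X h, 0) = g (X h)) (at_right 0)"
  proof eventually_elim
    case (elim h)
    have "s * (X h - R) = s\<^sup>2 * h"
      by (simp add: X_def power2_eq_square)
    then have "0 < s * (X h - R)"
      using elim(1) \<open>s \<noteq> 0\<close> by simp
    then show ?case
      using elim assms by (auto simp: side_region_def)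
  qed
  have "(R, 0) \<in> side_region s R T c"
    using assms by (auto simp: side_region_def)
  then have "(f \<longlongrightarrow> f (R, 0)) (at (R, 0) within side_region s R T c)"
    using assms(1) by (auto simp: continuous_on_def)
  then have "((\<lambda>h. f (X h, 0)) \<longlongrightarrow> f (R, 0)) (at_right 0)"
    using ev by (intro continuous_on_tendsto_compose[OF assms(1)])
      (auto intro!: tendsto_eq_intros X \<open>(R, 0) \<in> _\<close> elim: eventually_mono)
  moreover have "((\<lambda>h. f (X h, 0)) \<longlongrightarrow> g R) (at_right 0)"
    using isCont_tendsto_compose[OF g X]
    by (rule Lim_transform_eventually) (use ev in \<open>auto elim: eventually_mono\<close>)
  ultimately show ?thesis
    by (rule tendsto_unique[rotated]) simp
qed

text \<open>Passes from a neighbourhood of \<open>(R, 0)\<close> to a box. Half the radius suffices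
  because the distance is at most \<open>\<bar>r - R\<bar> + \<bar>t\<bar>\<close>.\<close>

lemma side_region_nearby:
  assumes "eventually P (at (R, 0) within side_region s R T c)" and "P (R, 0)"
  obtains \<eta> where "0 < \<eta>"
    "\<And>r t. (r, t) \<in> side_region s R T c \<Longrightarrow> \<bar>r - R\<bar> < \<eta> \<Longrightarrow> t < \<eta> \<Longrightarrow> P (r, t)"
proof -
  obtain d where "0 < d"
    and d: "\<And>p. p \<in> side_region s R T c \<Longrightarrow> p \<noteq> (R, 0) \<Longrightarrow> dist p (R, 0) < d \<Longrightarrow> P p"
    using assms(1) unfolding eventually_at by blast
  show ?thesis
  proof (rule that[of "d / 2"])
    fix r t assume rt: "(r, t) \<in> side_region s R T c" "\<bar>r - R\<bar> < d / 2" "t < d / 2"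
    have "dist (r, t) (R, 0) \<le> \<bar>r - R\<bar> + \<bar>t\<bar>"
      using sqrt_sum_squares_le_sum_abs[of "r - R" t] by (simp add: dist_Pair_Pair dist_real_def)
    also have "\<dots> < d"
      using rt by (auto simp: side_region_def)
    finally show "P (r, t)"
      using d rt(1) assms(2) by blast
  qed (use \<open>0 < d\<close> in simp)
qed

section \<open>Straight lines followed backwards in time\<close>

lemma has_real_derivative_within_atLeastLessThan_interior:
  assumes "(f has_real_derivative D) (at t within {0..<T})" "0 < t" "t < T"
  shows "(f has_real_derivative D) (at t)"
  using assms at_within_interior[of t "{0..<T}"] by simp

text \<open>
  Slopes \<open>a\<close> near \<open>ua\<close> differ from the front speed by a definite amount, with the sign that takes a
  line of slope \<open>a\<close> away from the front when it is followed backwards in time.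
\<close>

lemma side_region_backward_line:
  assumes c: "\<And>t. t \<in> {0..<T} \<Longrightarrow> (c has_real_derivative v t) (at t within {0..<T})"
    and v: "continuous_on {0..<T} v" and "0 < R" "0 < T" "0 < \<eta>"
    and s: "\<bar>s\<bar> = 1" "s * (ua - v 0) < 0"
  obtains \<delta> where "0 < \<delta>" "\<delta> \<le> \<eta>"
    "\<And>x \<tau> a t. (x, \<tau>) \<in> side_region s R T c \<Longrightarrow> \<bar>x - R\<bar> < \<delta> \<Longrightarrow> \<tau> < \<delta> \<Longrightarrow> \<bar>a - ua\<bar> < \<bar>ua - v 0\<bar> / 3
      \<Longrightarrow> 0 \<le> t \<Longrightarrow> t < \<tau>
      \<Longrightarrow> \<bar>x + a * (t - \<tau>) - R\<bar> < \<eta> \<and> 0 < x + a * (t - \<tau>) \<and> 0 < s * (x + a * (t - \<tau>) - R - c t)"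
proof -
  \<comment> \<open>A third of the gap: if \<open>a\<close> is within \<open>e\<close> of
    \<open>ua\<close> and \<open>v y\<close> within \<open>e\<close> of \<open>v 0\<close>, then
    \<open>a - v y\<close> keeps the sign of \<open>ua - v 0\<close>.\<close>
  define e where "e = \<bar>ua - v 0\<bar> / 3"
  have "0 < e"
    using s by (auto simp: e_def)
  obtain d where "0 < d" and d: "\<And>t. 0 \<le> t \<Longrightarrow> t < T \<Longrightarrow> t < d \<Longrightarrow> \<bar>v t - v 0\<bar> < e"
  proof -
    obtain d where "0 < d" "\<forall>t\<in>{0..<T}. dist t 0 < d \<longrightarrow> dist (v t) (v 0) < e"
      using v \<open>0 < T\<close> \<open>0 < e\<close> unfolding continuous_on_iff
      by (metis atLeastLessThan_iff order_refl)
    then show ?thesis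
      by (intro that[of d]) (auto simp: dist_real_def)
  qed
  \<comment> \<open>The bound \<open>R\<close> keeps the line at positive radius. In
    \<open>\<delta>\<close>, one half of \<open>\<eta>'\<close> pays for the distance of
    \<open>x\<close> from \<open>R\<close>, the other for the displacement along the line.\<close>
  define \<eta>' where "\<eta>' = min \<eta> R"
  define \<delta> where "\<delta> = min (\<eta>' / 2) (min d (\<eta>' / (2 * (\<bar>ua\<bar> + e + 1))))"
  have "0 < \<eta>'"
    using assms by (simp add: \<eta>'_def)
  have M: "0 < \<bar>ua\<bar> + e + 1"
    using \<open>0 < e\<close> by simp
  have "0 < \<delta>"
    using \<open>0 < \<eta>'\<close> \<open>0 < d\<close> M by (simp add: \<delta>_def)
  have "(\<bar>ua\<bar> + e + 1) * \<delta> \<le> (\<bar>ua\<bar> + e + 1) * (\<eta>' / (2 * (\<bar>ua\<bar> + e + 1)))"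
    using M by (intro mult_left_mono) (auto simp: \<delta>_def)
  also have "\<dots> = \<eta>' / 2"
    using M by (simp add: field_simps)
  finally have M\<delta>: "(\<bar>ua\<bar> + e + 1) * \<delta> \<le> \<eta>' / 2" .
  show ?thesis
  proof (rule that[of \<delta>])
    show "\<delta> \<le> \<eta>"
      using \<open>0 < \<eta>'\<close> by (auto simp: \<delta>_def \<eta>'_def)
    fix x \<tau> a t
    assume x: "(x, \<tau>) \<in> side_region s R T c" "\<bar>x - R\<bar> < \<delta>" "\<tau> < \<delta>"
      and a: "\<bar>a - ua\<bar> < \<bar>ua - v 0\<bar> / 3" and t: "0 \<le> t" "t < \<tau>"
    have a': "\<bar>a - ua\<bar> < e"
      using a by (simp add: e_def)
    have \<tau>: "\<tau> < T" "0 \<le> s * (x - R - c \<tau>)"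
      using x by (auto simp: side_region_def)
    have "\<bar>a * (t - \<tau>)\<bar> \<le> (\<bar>ua\<bar> + e + 1) * \<delta>"
      unfolding abs_mult by (intro mult_mono) (use a' t x in auto)
    moreover have "\<delta> \<le> \<eta>' / 2"
      unfolding \<delta>_def by (rule min.cobounded1)
    ultimately have near: "\<bar>x + a * (t - \<tau>) - R\<bar> < \<eta>'"
      using M\<delta> x(2) by linarith
    \<comment> \<open>The signed distance from the front along the line. Its derivative
      \<open>s * (a - v y)\<close> is negative, so going back from \<open>\<tau>\<close> it
      increases strictly from a value that is at least 0.\<close>
    define F where "F = (\<lambda>t. s * (x + a * (t - \<tau>) - R - c t))"
    have DF: "(F has_real_derivative s * (a - v y)) (at y within {0..<T})" if "y \<in> {0..<T}" for y
      unfolding F_def by (auto intro!: derivative_eq_intros c that)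
    have "F \<tau> < F t"
    proof (rule DERIV_neg_imp_decreasing_open[OF t(2)])
      fix y assume y: "t < y" "y < \<tau>"
      have "\<bar>v y - v 0\<bar> < e"
        using y t x \<tau> by (intro d) (auto simp: \<delta>_def)
      then have "s * (a - v y) < 0"
        using a' s by (auto simp: e_def abs_if split: if_splits)
      moreover have "(F has_real_derivative s * (a - v y)) (at y)"
        using DF[of y] y t \<tau> by (intro has_real_derivative_within_atLeastLessThan_interior[of F _ y T]) auto
      ultimately show "\<exists>D. (F has_real_derivative D) (at y) \<and> D < 0"
        by blast
    next
      have "continuous_on {0..<T} F"
        using DF by (intro DERIV_continuous_on) auto
      then show "continuous_on {t..\<tau>} F"
        by (rule continuous_on_subset) (use t \<tau> in auto)
    qed
    moreover have "0 \<le> F \<tau>"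
      using \<tau> by (simp add: F_def)
    ultimately show "\<bar>x + a * (t - \<tau>) - R\<bar> < \<eta> \<and> 0 < x + a * (t - \<tau>) \<and> 0 < s * (x + a * (t - \<tau>) - R - c t)"
      using near by (auto simp: F_def \<eta>'_def)
  qed (rule \<open>0 < \<delta>\<close>)
qed

section \<open>Propagation of the initial data to the front\<close>

text \<open>The lower bound on \<open>m\<close> makes \<open>(g t)\<^sup>2 * exp (2 * K * t)\<close>
  nondecreasing; it is nonnegative at 0 and vanishes at \<open>\<tau>\<close>.\<close>

lemma backward_Gronwall_zero:
  fixes g :: "real \<Rightarrow> real"
  assumes "0 \<le> \<tau>" and g: "continuous_on {0..\<tau>} g" "g \<tau> = 0"
    and D: "\<And>t. 0 < t \<Longrightarrow> t < \<tau> \<Longrightarrow> (g has_real_derivative m t * g t) (at t)"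
    and m: "\<And>t. 0 < t \<Longrightarrow> t < \<tau> \<Longrightarrow> - K \<le> m t"
  shows "g 0 = 0"
proof -
  define h where "h = (\<lambda>t. (g t)\<^sup>2 * exp (2 * K * t))"
  have "h 0 \<le> h \<tau>"
  proof (rule DERIV_nonneg_imp_increasing_open[OF \<open>0 \<le> \<tau>\<close>])
    fix t assume t: "0 < t" "t < \<tau>"
    have "(h has_real_derivative 2 * (g t)\<^sup>2 * exp (2 * K * t) * (m t + K)) (at t)"
      unfolding h_def
      by (auto intro!: derivative_eq_intros D t simp: power2_eq_square algebra_simps)
    moreover have "0 \<le> 2 * (g t)\<^sup>2 * exp (2 * K * t) * (m t + K)"
      using m[OF t] by (intro mult_nonneg_nonneg) auto
    ultimately show "\<exists>y. (h has_real_derivative y) (at t) \<and> 0 \<le> y"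
      by blast
  next
    show "continuous_on {0..\<tau>} h"
      unfolding h_def by (intro continuous_intros g)
  qed
  then show ?thesis
    using g by (simp add: h_def)
qed

lemma has_real_derivative_along_line:
  fixes f :: "real \<times> real \<Rightarrow> real"
  assumes "(f has_derivative D) (at (x + a * (t - \<tau>), t))"
  shows "((\<lambda>t. f (x + a * (t - \<tau>), t)) has_real_derivative D (a, 1)) (at t)"
proof -
  have "((\<lambda>t. (x + a * (t - \<tau>), t)) has_derivative (\<lambda>h. (a * h, h))) (at t)"
    by (auto intro!: derivative_eq_intros)
  from has_derivative_compose[OF this assms]
  have "((\<lambda>t. f (x + a * (t - \<tau>), t)) has_derivative (\<lambda>h. D (a * h, h))) (at t)" .
  moreover have "D (a * h, h) = D (a, 1) * h" for h
    using linear_scale[OF has_derivative_linear[OF assms], of h "(a,1)"] by (simp add: mult.commute)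
  ultimately show ?thesis
    by (simp add: has_field_derivative_def)
qed

text \<open>The full power \<open>g t powr k\<close> is kept as a factor so that, in a product rule,
  this term cancels against the geometric source term with coefficient
  \<open>(real n - 1) / r\<close>.\<close>

lemma has_real_derivative_powr_chain:
  fixes g :: "real \<Rightarrow> real"
  assumes "(g has_real_derivative D) (at t within S)" "0 < g t"
  shows "((\<lambda>t. g t powr k) has_real_derivative k / g t * g t powr k * D) (at t within S)"
proof (rule DERIV_chain2[where f="\<lambda>x. x powr k", OF _ assms(1)])
  show "((\<lambda>x. x powr k) has_real_derivative k / g t * g t powr k) (at (g t))"
    using has_real_derivative_powr[OF assms(2), of k] assms(2) by (simp add: powr_diff)
qed

text \<open>The condition \<open>s * (ua - v 0) < 0\<close> says that particles with the initial
  velocity run into the front from side \<open>s\<close>; traced backwards they stay on that side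
  and reach \<open>t = 0\<close>. Constancy of \<open>u\<close> comes first; it reduces the mass
  balance to a linear equation for \<open>\<rho>\<close> along lines of slope
  \<open>ua\<close>.\<close>

lemma outer_state_near_front:
  fixes \<rho> u :: "real \<times> real \<Rightarrow> real" and s R T :: real and c :: "real \<Rightarrow> real"
  defines "S \<equiv> side_region s R T c"
  assumes c: "\<And>t. t \<in> {0..<T} \<Longrightarrow> (c has_real_derivative v t) (at t within {0..<T})"
    and v: "continuous_on {0..<T} v" and "c 0 = 0" "0 < R" "0 < T"
    and s: "\<bar>s\<bar> = 1" "s * (ua - v 0) < 0"
    and \<rho>: "C1_on \<rho> S" and u: "C1_on u S" and sol: "solves_system n \<rho> u (interior S)"
    and "0 < \<rho>a"
    and init: "\<And>r. 0 < r \<Longrightarrow> 0 < s * (r - R) \<Longrightarrow> \<rho> (r, 0) = \<rho>a * r powr (1 - real n) \<and> u (r, 0) = ua"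
  obtains \<delta> where "0 < \<delta>"
    "\<And>r t. (r, t) \<in> S \<Longrightarrow> \<bar>r - R\<bar> < \<delta> \<Longrightarrow> t < \<delta> \<Longrightarrow> \<rho> (r, t) = \<rho>a * r powr (1 - real n) \<and> u (r, t) = ua"
proof -
  have S0: "(R, 0) \<in> S"
    using assms by (auto simp: S_def side_region_def)
  have cc: "continuous_on {0..<T} c"
    using c by (intro DERIV_continuous_on) auto
  note \<rho>c = C1_on_imp_continuous_on[OF \<rho>] and uc = C1_on_imp_continuous_on[OF u]
  obtain D\<rho> where D\<rho>: "\<And>p. p \<in> S \<Longrightarrow> (\<rho> has_derivative blinfun_apply (D\<rho> p)) (at p within S)"
    using \<rho> unfolding C1_on_def by blast
  obtain Du where Du: "\<And>p. p \<in> S \<Longrightarrow> (u has_derivative blinfun_apply (Du p)) (at p within S)"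
    and Duc: "continuous_on S Du"
    using u unfolding C1_on_def by blast
  have "s \<noteq> 0"
    using s by auto
  have \<rho>R: "\<rho> (R, 0) = \<rho>a * R powr (1 - real n)"
    using \<open>0 < R\<close> \<open>0 < T\<close> \<open>c 0 = 0\<close> \<open>s \<noteq> 0\<close> init
    by (intro side_region_trace[OF \<rho>c[unfolded S_def]]) (auto intro!: continuous_intros)
  have uR: "u (R, 0) = ua"
    using \<open>0 < R\<close> \<open>0 < T\<close> \<open>c 0 = 0\<close> \<open>s \<noteq> 0\<close> init
    by (intro side_region_trace[OF uc[unfolded S_def], where g="\<lambda>_. ua"]) auto
  have start: "\<rho> (r, 0) = \<rho>a * r powr (1 - real n) \<and> u (r, 0) = ua" if "(r, 0) \<in> S" for r
  proof (cases "r = R")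
    case False
    then have "0 < s * (r - R)"
      using that \<open>s \<noteq> 0\<close> \<open>c 0 = 0\<close> by (auto simp: S_def side_region_def less_le)
    then show ?thesis
      using that init by (auto simp: S_def side_region_def)
  qed (use \<rho>R uR in auto)
  define e where "e = \<bar>ua - v 0\<bar> / 3"
  define K where "K = norm (Du (R, 0)) + 1"
  have "0 < e"
    using s by (auto simp: e_def)
  \<comment> \<open>Positive density allows the transport form, \<open>e\<close> is the tolerance
    for slopes of backward lines, and \<open>K\<close> is the constant for the Gronwall
    argument.\<close>
  define P where "P = (\<lambda>p. 0 < \<rho> p \<and> \<bar>u p - ua\<bar> < e \<and> norm (Du p) < K)"
  have "eventually P (at (R, 0) within S)"
    unfolding P_def
  proof (intro eventually_conj)
    show "\<forall>\<^sub>F p in at (R, 0) within S. 0 < \<rho> p"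
      using \<rho>c S0 \<open>0 < \<rho>a\<close> \<open>0 < R\<close>
      by (intro order_tendstoD(1)[of \<rho> "\<rho> (R, 0)"]) (auto simp: continuous_on_def \<rho>R)
    show "\<forall>\<^sub>F p in at (R, 0) within S. \<bar>u p - ua\<bar> < e"
      using uc S0 \<open>0 < e\<close> tendstoD[of u "u (R, 0)" "at (R, 0) within S" e]
      by (auto simp: continuous_on_def uR dist_real_def)
    have "continuous_on S (\<lambda>p. norm (Du p))"
      by (intro continuous_intros Duc)
    then show "\<forall>\<^sub>F p in at (R, 0) within S. norm (Du p) < K"
      using S0 by (intro order_tendstoD(2)[of _ "norm (Du (R, 0))"]) (auto simp: continuous_on_def K_def)
  qed
  moreover have "P (R, 0)"
    using \<open>0 < \<rho>a\<close> \<open>0 < R\<close> \<open>0 < e\<close> by (auto simp: P_def \<rho>R uR K_def)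
  ultimately obtain \<eta> where "0 < \<eta>"
    and \<eta>: "\<And>r t. (r, t) \<in> S \<Longrightarrow> \<bar>r - R\<bar> < \<eta> \<Longrightarrow> t < \<eta> \<Longrightarrow> P (r, t)"
    unfolding S_def by (rule side_region_nearby) blast
  obtain \<delta> where "0 < \<delta>" "\<delta> \<le> \<eta>" and \<delta>: "\<And>x \<tau> a t. (x, \<tau>) \<in> S \<Longrightarrow> \<bar>x - R\<bar> < \<delta> \<Longrightarrow> \<tau> < \<delta> \<Longrightarrow>
      \<bar>a - ua\<bar> < e \<Longrightarrow> 0 \<le> t \<Longrightarrow> t < \<tau> \<Longrightarrow> \<bar>x + a * (t - \<tau>) - R\<bar> < \<eta> \<and> 0 < x + a * (t - \<tau>) \<and>
      0 < s * (x + a * (t - \<tau>) - R - c t)"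
    using side_region_backward_line[OF c v \<open>0 < R\<close> \<open>0 < T\<close> \<open>0 < \<eta>\<close> s] unfolding S_def e_def by metis
  \<comment> \<open>Strictly between times 0 and \<open>\<tau>\<close> the line is in the interior,
    where derivatives are two-sided and the system holds. The end at \<open>\<tau>\<close> may lie
    on the front.\<close>
  have int: "(x + a * (t - \<tau>), t) \<in> interior S"
    if "(x, \<tau>) \<in> S" "\<bar>x - R\<bar> < \<delta>" "\<tau> < \<delta>" "\<bar>a - ua\<bar> < e" "0 < t" "t < \<tau>" for x \<tau> a t
    unfolding S_def using that \<delta>[OF that(1-4), of t]
    by (intro interior_side_region[OF cc]) (auto simp: S_def side_region_def)
  have mem: "(x + a * (t - \<tau>), t) \<in> S"
    if "(x, \<tau>) \<in> S" "\<bar>x - R\<bar> < \<delta>" "\<tau> < \<delta>" "\<bar>a - ua\<bar> < e" "0 \<le> t" "t \<le> \<tau>" for x \<tau> a t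
  proof (cases "t = \<tau>")
    case False
    then show ?thesis
      using that \<delta>[OF that(1-4), of t] by (auto simp: S_def side_region_def)
  qed (use that in simp)
  have line_cont: "continuous_on {0..\<tau>} (\<lambda>t. f (x + a * (t - \<tau>), t))"
    if "(x, \<tau>) \<in> S" "\<bar>x - R\<bar> < \<delta>" "\<tau> < \<delta>" "\<bar>a - ua\<bar> < e" "continuous_on S f"
    for x \<tau> a and f :: "real \<times> real \<Rightarrow> real"
    by (rule continuous_on_compose2[OF \<open>continuous_on S f\<close>])
      (use mem[OF that(1-4)] in \<open>auto intro!: continuous_intros\<close>)
  note intD = subsetD[OF interior_subset]
  have at_int: "(\<rho> has_derivative blinfun_apply (D\<rho> p)) (at p)" "(u has_derivative blinfun_apply (Du p)) (at p)"
    if "p \<in> interior S" for p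
    using D\<rho>[OF intD[OF that]] Du[OF intD[OF that]] by (simp_all add: at_within_interior[OF that])
  have u_eq: "u (x, \<tau>) = ua" if x: "(x, \<tau>) \<in> S" "\<bar>x - R\<bar> < \<delta>" "\<tau> < \<delta>" for x \<tau>
  proof (cases "0 < \<tau>")
    case False
    then show ?thesis
      using x start by (auto simp: S_def side_region_def)
  next
    case True
    define a where "a = u (x, \<tau>)"
    have a: "\<bar>a - ua\<bar> < e"
      using \<eta>[OF x(1)] x \<open>\<delta> \<le> \<eta>\<close> by (auto simp: P_def a_def)
    \<comment> \<open>Along the line of fixed slope \<open>a\<close>, rather than along the characteristic curve, \<open>u - a\<close> solves a
      linear ODE; no characteristic has to be constructed.\<close>
    define g where "g = (\<lambda>t. u (x + a * (t - \<tau>), t) - a)"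
    have "g 0 = 0"
    proof (rule backward_Gronwall_zero)
      show "continuous_on {0..\<tau>} g"
        unfolding g_def by (intro continuous_intros line_cont x a uc)
      show "g \<tau> = 0"
        by (simp add: g_def a_def)
      fix t assume t: "0 < t" "t < \<tau>"
      let ?p = "(x + a * (t - \<tau>), t)"
      have p: "?p \<in> interior S"
        using int x a t by blast
      have Pp: "P ?p"
        using \<delta>[OF x a, of t] t x \<open>\<delta> \<le> \<eta>\<close> by (intro \<eta> intD[OF p]) auto
      have "Du ?p (u ?p, 1) = 0"
        using Pp by (intro solves_system_transport(1)[OF sol p at_int[OF p]]) (auto simp: P_def)
      \<comment> \<open>The direction of the line differs from the characteristic one by
        \<open>g\<close>: \<open>(a, 1) = (u ?p, 1) - g t *\<^sub>R (1, 0)\<close>.\<close>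
      then have "Du ?p (a, 1) = - Du ?p (1, 0) * g t"
        using blinfun.add_right[of "Du ?p" "(u ?p, 1)" "- g t *\<^sub>R (1, 0)"]
        by (simp add: g_def blinfun.scaleR_right blinfun.minus_right del: scaleR_Pair)
           (simp add: algebra_simps)
      then show "(g has_real_derivative - Du ?p (1, 0) * g t) (at t)"
        using has_real_derivative_along_line[OF at_int(2)[OF p]]
        unfolding g_def by (auto intro!: derivative_eq_intros)
      have "\<bar>Du ?p (1, 0)\<bar> \<le> norm (Du ?p)"
        using norm_blinfun[of "Du ?p" "(1, 0)"] by simp
      then show "- K \<le> - Du ?p (1, 0)"
        using Pp by (auto simp: P_def)
    qed (use True in simp)
    moreover have "(x + a * (0 - \<tau>), 0) \<in> S"
      by (rule mem[OF x a]) (use True in auto)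
    ultimately show ?thesis
      using start by (auto simp: g_def a_def)
  qed
  \<comment> \<open>Second shrinking: backward lines from the smaller box stay in the box where
    \<open>u = ua\<close> is already known.\<close>
  obtain \<delta>' where "0 < \<delta>'" "\<delta>' \<le> \<delta>" and \<delta>': "\<And>x \<tau> a t. (x, \<tau>) \<in> S \<Longrightarrow> \<bar>x - R\<bar> < \<delta>' \<Longrightarrow> \<tau> < \<delta>' \<Longrightarrow>
      \<bar>a - ua\<bar> < e \<Longrightarrow> 0 \<le> t \<Longrightarrow> t < \<tau> \<Longrightarrow> \<bar>x + a * (t - \<tau>) - R\<bar> < \<delta> \<and> 0 < x + a * (t - \<tau>) \<and>
      0 < s * (x + a * (t - \<tau>) - R - c t)"
    using side_region_backward_line[OF c v \<open>0 < R\<close> \<open>0 < T\<close> \<open>0 < \<delta>\<close> s] unfolding S_def e_def by metis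
  have "\<rho> (x, \<tau>) = \<rho>a * x powr (1 - real n)" if x: "(x, \<tau>) \<in> S" "\<bar>x - R\<bar> < \<delta>'" "\<tau> < \<delta>'" for x \<tau>
  proof (cases "0 < \<tau>")
    case False
    then show ?thesis
      using x start by (auto simp: S_def side_region_def)
  next
    case True
    have a: "\<bar>ua - ua\<bar> < e"
      using \<open>0 < e\<close> by simp
    have x\<delta>: "\<bar>x - R\<bar> < \<delta>" "\<tau> < \<delta>"
      using x \<open>\<delta>' \<le> \<delta>\<close> by auto
    define X where "X = (\<lambda>t. x + ua * (t - \<tau>))"
    define k where "k = real n - 1"
    have X: "0 < X t" if "0 \<le> t" "t \<le> \<tau>" for t
      using mem[OF x(1) x\<delta> a that] by (auto simp: S_def side_region_def X_def)
    \<comment> \<open>The density per unit radius of a spherical shell, up to a constant; the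
      geometric source term makes this weighted density constant along particle paths.\<close>
    define y where "y = (\<lambda>t. \<rho> (X t, t) * X t powr k)"
    have "y \<tau> = y 0"
    proof (rule DERIV_isconst_end[OF True])
      show "continuous_on {0..\<tau>} y"
        unfolding y_def X_def using X
        by (intro continuous_intros line_cont[OF x(1) x\<delta> a \<rho>c]) (auto simp: X_def less_le)
      fix t assume t: "0 < t" "t < \<tau>"
      let ?p = "(X t, t)"
      have p: "?p \<in> interior S"
        using int[OF x(1) x\<delta> a t] by (simp add: X_def)
      have near: "\<bar>X t - R\<bar> < \<delta>"
        using \<delta>'[OF x a, of t] t by (simp add: X_def)
      have "P ?p"
        using near t x\<delta> \<open>\<delta> \<le> \<eta>\<close> by (intro \<eta> intD[OF p]) auto
      then have "\<rho> ?p \<noteq> 0"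
        by (simp add: P_def)
      have up: "u ?p = ua"
        using u_eq[OF intD[OF p]] near t x\<delta> by auto
      \<comment> \<open>An open neighbourhood on which \<open>u\<close> is constant, so that its
        derivative at \<open>?p\<close> vanishes.\<close>
      define U where "U = interior S \<inter> {R - \<delta><..<R + \<delta>} \<times> {..<\<delta>}"
      have "(u has_derivative (\<lambda>_. 0)) (at ?p)"
      proof (rule has_derivative_transform_within_open[of "\<lambda>_. ua" _ _ UNIV U])
        show "open U"
          unfolding U_def by (intro open_Int open_Times) auto
        show "?p \<in> U"
          using p near t x\<delta> by (auto simp: U_def)
        show "ua = u q" if "q \<in> U" for q
          using that u_eq[of "fst q" "snd q"] by (cases q) (auto simp: U_def dest: intD)
      qed simp
      then have "Du ?p (1, 0) = 0"
        using has_derivative_unique[OF _ at_int(2)[OF p]] by metis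
      then have "D\<rho> ?p (ua, 1) = - (k / X t * ua * \<rho> ?p)"
        using solves_system_transport(2)[OF sol p at_int[OF p] \<open>\<rho> ?p \<noteq> 0\<close>]
        by (simp add: up k_def eq_neg_iff_add_eq_0 mult_ac)
      then have D\<rho>X: "((\<lambda>t. \<rho> (X t, t)) has_real_derivative - (k / X t * ua * \<rho> ?p)) (at t)"
        using has_real_derivative_along_line[OF at_int(1)[OF p[unfolded X_def]]] by (simp add: X_def)
      have "((\<lambda>t. X t powr k) has_real_derivative k / X t * X t powr k * ua) (at t)"
        using t X[of t]
        by (intro has_real_derivative_powr_chain) (auto simp: X_def intro!: derivative_eq_intros)
      from DERIV_mult[OF D\<rho>X this] show "(y has_real_derivative 0) (at t)"
        by (simp add: y_def mult_ac)
    qed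
    moreover have "(X 0, 0) \<in> S"
      unfolding X_def by (rule mem[OF x(1) x\<delta> a]) (use True in auto)
    ultimately have "\<rho> (x, \<tau>) * x powr k = \<rho>a * (X 0 powr (- k) * X 0 powr k)"
      using start by (simp add: y_def X_def k_def mult_ac)
    also have "\<dots> = \<rho>a"
      using X[of 0] True by (simp flip: powr_add)
    finally have "\<rho>a * x powr (- k) = \<rho> (x, \<tau>) * (x powr k * x powr (- k))"
      by (simp add: mult_ac)
    then show ?thesis
      using X[of \<tau>] True by (simp add: X_def k_def flip: powr_add)
  qed
  then show ?thesis
    using u_eq \<open>0 < \<delta>'\<close> \<open>\<delta>' \<le> \<delta>\<close> by (intro that[of \<delta>']) auto
qed

section \<open>The speed of the front\<close>

text \<open>With \<open>a = v - ul < b = v - ur\<close>, the case \<open>0 \<le> a\<close> gives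
  \<open>\<rho>l * a * a \<le> \<rho>r * b * a < \<rho>r * b * b\<close>, against the equation. The
  case \<open>b \<le> 0\<close> is excluded in the same way, using \<open>a < 0\<close>.\<close>

lemma overcompressive_speed:
  fixes \<rho>l \<rho>r ul ur v :: real
  assumes "0 < \<rho>l" "0 < \<rho>r" "ur < ul"
    and eq: "\<rho>r * (v - ur)\<^sup>2 = \<rho>l * (v - ul)\<^sup>2" and mass: "0 \<le> \<rho>r * (v - ur) - \<rho>l * (v - ul)"
  shows "ur < v" "v < ul"
proof -
  define a where "a = v - ul"
  define b where "b = v - ur"
  have "a < b"
    using assms by (simp add: a_def b_def)
  have eq': "\<rho>r * b * b = \<rho>l * a * a" and mass': "\<rho>l * a \<le> \<rho>r * b"
    using eq mass by (simp_all add: a_def b_def power2_eq_square mult_ac)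
  have "a < 0"
  proof (rule ccontr)
    assume "\<not> a < 0"
    then have "\<rho>l * a * a \<le> \<rho>r * b * a" "\<rho>r * b * a < \<rho>r * b * b"
      using mass' \<open>a < b\<close> \<open>0 < \<rho>r\<close> by (auto intro: mult_right_mono)
    then show False
      using eq' by simp
  qed
  moreover have "0 < b"
  proof (rule ccontr)
    assume "\<not> 0 < b"
    then have "\<rho>r * b * b \<le> \<rho>l * a * b"
      using mass' by (intro mult_right_mono_neg) auto
    moreover have "\<rho>l * a * b < \<rho>l * a * a"
      using \<open>a < 0\<close> \<open>a < b\<close> \<open>0 < \<rho>l\<close> by (intro mult_strict_left_mono_neg) (auto simp: mult_pos_neg)
    ultimately show False
      using eq' by simp
  qed
  ultimately show "ur < v" "v < ul"
    by (auto simp: a_def b_def)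
qed

text \<open>The speed of a delta shock in pressureless gas dynamics with constant outer
  states.\<close>

definition shock_speed :: "real \<Rightarrow> real \<Rightarrow> real \<Rightarrow> real \<Rightarrow> real" where
  "shock_speed \<rho>l ul \<rho>r ur = (sqrt \<rho>l * ul + sqrt \<rho>r * ur) / (sqrt \<rho>l + sqrt \<rho>r)"

text \<open>Between \<open>ur\<close> and \<open>ul\<close> both differences have a known sign, so
  taking square roots leaves a linear equation for \<open>q\<close>.\<close>

lemma shock_speed_unique:
  assumes "0 < \<rho>l" "0 < \<rho>r" "ur < q" "q < ul"
    and eq: "\<rho>r * (q - ur)\<^sup>2 = \<rho>l * (q - ul)\<^sup>2"
  shows "q = shock_speed \<rho>l ul \<rho>r ur"
proof -
  have "sqrt \<rho>r * \<bar>q - ur\<bar> = sqrt \<rho>l * \<bar>q - ul\<bar>"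
    using arg_cong[OF eq, of sqrt] unfolding real_sqrt_mult real_sqrt_abs .
  then have "sqrt \<rho>r * (q - ur) = sqrt \<rho>l * (ul - q)"
    using assms by simp
  moreover have "sqrt \<rho>l + sqrt \<rho>r \<noteq> 0"
    using assms by (simp add: add_pos_pos less_imp_neq[symmetric])
  ultimately show ?thesis
    by (simp add: shock_speed_def field_simps)
qed

text \<open>
  With constant jumps the mass and momentum balances integrate to \<open>m = A c - B t\<close> and
  \<open>m v = B c - C t\<close>.  Eliminating \<open>m\<close> shows that \<open>A c\<^sup>2 - 2 B c t + C t\<^sup>2\<close> has derivative zero, so
  \<open>c t / t\<close> is a root of a fixed quadratic.
\<close>

lemma front_line:
  fixes c m v :: "real \<Rightarrow> real"
  assumes "0 < \<rho>l" "0 < \<rho>r"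
    and c: "\<And>t. t \<in> {0..<T} \<Longrightarrow> (c has_real_derivative v t) (at t within {0..<T})"
    and m: "\<And>t. t \<in> {0..<T} \<Longrightarrow>
      (m has_real_derivative v t * (\<rho>r - \<rho>l) - (\<rho>r * ur - \<rho>l * ul)) (at t within {0..<T})"
    and mv: "\<And>t. t \<in> {0..<T} \<Longrightarrow> ((\<lambda>t. m t * v t) has_real_derivative
      v t * (\<rho>r * ur - \<rho>l * ul) - (\<rho>r * ur\<^sup>2 - \<rho>l * ul\<^sup>2)) (at t within {0..<T})"
    and "c 0 = 0" "m 0 = 0" and v: "\<And>t. t \<in> {0..<T} \<Longrightarrow> ur < v t \<and> v t < ul"
    and t: "t \<in> {0..<T}"
  defines "s0 \<equiv> shock_speed \<rho>l ul \<rho>r ur"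
  shows "c t = s0 * t" "v t = s0" "m t = ((\<rho>r - \<rho>l) * s0 - (\<rho>r * ur - \<rho>l * ul)) * t"
proof -
  define A B C where "A = \<rho>r - \<rho>l" and "B = \<rho>r * ur - \<rho>l * ul" and "C = \<rho>r * ur\<^sup>2 - \<rho>l * ul\<^sup>2"
  note ABC = A_def[symmetric] B_def[symmetric] C_def[symmetric]
  have zero: "f x = 0" if "\<And>t. t \<in> {0..<T} \<Longrightarrow> (f has_real_derivative 0) (at t within {0..<T})"
    "f 0 = 0" "x \<in> {0..<T}" for f :: "real \<Rightarrow> real" and x
    using has_field_derivative_zero_constant[of "{0..<T}" f] that by (metis atLeastLessThan_iff
        convex_real_interval(7) order_refl order.strict_trans1)
  have m_eq: "m t = A * c t - B * t" if "t \<in> {0..<T}" for t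
  proof -
    have "m t - (A * c t - B * t) = 0"
      by (rule zero[OF _ _ that]) (auto intro!: derivative_eq_intros m[unfolded ABC] c simp: assms(6,7))
    then show ?thesis by simp
  qed
  have mv_eq: "m t * v t = B * c t - C * t" if "t \<in> {0..<T}" for t
  proof -
    define p where "p = (\<lambda>t. m t * v t)"
    have "p t - (B * c t - C * t) = 0"
      by (rule zero[OF _ _ that])
        (auto intro!: derivative_eq_intros mv[unfolded ABC, folded p_def] c simp: assms(6,7) p_def[THEN fun_cong, of 0])
    then show ?thesis by (simp add: p_def)
  qed
  have quad: "A * (c t)\<^sup>2 - 2 * B * c t * t + C * t\<^sup>2 = 0" if "t \<in> {0..<T}" for t
  proof (rule zero[OF _ _ that])
    fix t assume t: "t \<in> {0..<T}"
    \<comment> \<open>The bracket is \<open>v t * (A * c t - B * t) - (B * c t - C * t)\<close>,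
      that is, \<open>v t * m t - m t * v t\<close>.\<close>
    have "2 * (A * c t * v t - B * (v t * t + c t) + C * t) = 0"
      using m_eq[OF t] mv_eq[OF t] by algebra
    then show "((\<lambda>t. A * (c t)\<^sup>2 - 2 * B * c t * t + C * t\<^sup>2) has_real_derivative 0) (at t within {0..<T})"
      by (auto intro!: derivative_eq_intros c t simp: algebra_simps)
  qed (simp add: \<open>c 0 = 0\<close>)
  have c_eq: "c t = s0 * t" if t: "t \<in> {0..<T}" for t
  proof (cases "t = 0")
    case False
    then have "0 < t"
      using t by simp
    have "continuous_on {0..<T} c"
      using c by (intro DERIV_continuous_on) auto
    then have "continuous_on {0..t} c"
      by (rule continuous_on_subset) (use t in auto)
    moreover have "(c has_real_derivative v z) (at z)" if "0 < z" "z < t" for z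
      using c[of z] that t by (intro has_real_derivative_within_atLeastLessThan_interior[of c _ z T]) auto
    \<comment> \<open>The mean value theorem writes \<open>c t / t\<close> as a value of
      \<open>v\<close>. It therefore lies strictly between \<open>ur\<close> and \<open>ul\<close>,
      which selects the root of the quadratic.\<close>
    ultimately obtain z where z: "0 < z" "z < t" "c t = t * v z"
      using MVT[OF \<open>0 < t\<close>, of c] by (metis DERIV_unique \<open>c 0 = 0\<close> diff_zero real_differentiable_def)
    define q where "q = v z"
    have "ur < q" "q < ul"
      using v[of z] z t by (auto simp: q_def)
    have "(A * q\<^sup>2 - 2 * B * q + C) * t\<^sup>2 = 0"
      using quad[OF t] by (simp add: z q_def power2_eq_square algebra_simps)
    then have "A * q\<^sup>2 - 2 * B * q + C = 0"
      using \<open>0 < t\<close> by simp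
    then have "\<rho>r * (q - ur)\<^sup>2 = \<rho>l * (q - ul)\<^sup>2"
      by (simp add: A_def B_def C_def power2_eq_square algebra_simps)
    then have "q = s0"
      unfolding s0_def by (intro shock_speed_unique assms \<open>ur < q\<close> \<open>q < ul\<close>)
    then show ?thesis
      using z by (simp add: q_def)
  qed (simp add: \<open>c 0 = 0\<close>)
  show "c t = s0 * t"
    by (rule c_eq[OF t])
  \<comment> \<open>Uniqueness of the derivative relative to \<open>{0..<T}\<close> gives the speed
    at \<open>t = 0\<close> as well.\<close>
  have "(c has_real_derivative s0) (at t within {0..<T})"
    by (rule has_field_derivative_transform_within[of "\<lambda>t. s0 * t" _ _ _ 1])
      (use t in \<open>auto intro!: derivative_eq_intros simp: c_eq\<close>)
  then show "v t = s0"
    using c[OF t] vector_derivative_unique_within[OF at_within_atLeastLessThan_neq_bot[OF t]]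
    by (metis has_real_derivative_iff_has_vector_derivative)
  show "m t = ((\<rho>r - \<rho>l) * s0 - (\<rho>r * ur - \<rho>l * ul)) * t"
    using m_eq[OF t] c_eq[OF t] by (simp add: A_def B_def algebra_simps)
qed

section \<open>Reduction of a physical solution to an explicit wave\<close>

lemma left_region_eq_side_region: "left_region R W = side_region (- 1) R (lifetime W) (front W)"
  by (auto simp: left_region_def side_region_def)

text \<open>\<open>side_region\<close> demands \<open>0 < r\<close>; right of the front this follows
  from the positive position of the front.\<close>

lemma right_region_eq_side_region:
  assumes "\<And>t. t \<in> {0..<lifetime W} \<Longrightarrow> 0 < R + front W t"
  shows "right_region R W = side_region 1 R (lifetime W) (front W)"
  using assms by (fastforce simp: right_region_def side_region_def)

text \<open>The solution in closed form: multiplied by the spherical weight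
  \<open>(R + s0 * t) powr (real n - 1)\<close>, the mass grows linearly. One
  \<open>\<delta>\<close> bounds both the distance from \<open>R\<close> and the time.\<close>

definition straight_shadow_wave ::
    "nat \<Rightarrow> real \<Rightarrow> real \<Rightarrow> real \<Rightarrow> real \<Rightarrow> real \<Rightarrow> real \<Rightarrow> shadow_wave \<Rightarrow> bool" where
  "straight_shadow_wave n R \<rho>l ul \<rho>r ur \<delta> W \<longleftrightarrow> \<delta> \<le> lifetime W \<and>
     (let s0 = shock_speed \<rho>l ul \<rho>r ur in
      \<forall>t\<in>{0..<\<delta>}.
        front W t = s0 * t \<and> speed W t = s0 \<and>
        mass W t = ((\<rho>r - \<rho>l) * s0 - (\<rho>r * ur - \<rho>l * ul)) * t * (R + s0 * t) powr (1 - real n) \<and>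
        (\<forall>r. \<bar>r - R\<bar> < \<delta> \<and> 0 < r \<and> r \<le> R + front W t \<longrightarrow>
           rho0 W (r, t) = \<rho>l * r powr (1 - real n) \<and> u0 W (r, t) = ul) \<and>
        (\<forall>r. \<bar>r - R\<bar> < \<delta> \<and> R + front W t \<le> r \<longrightarrow>
           rho1 W (r, t) = \<rho>r * r powr (1 - real n) \<and> u1 W (r, t) = ur))"

text \<open>The closed form involves only \<open>n\<close>, \<open>R\<close> and the four data
  constants, so two such waves agree on the smaller neighbourhood.\<close>

lemma straight_shadow_waves_coincide:
  assumes "straight_shadow_wave n R \<rho>l ul \<rho>r ur \<delta> W" "straight_shadow_wave n R \<rho>l ul \<rho>r ur \<delta>' W'"
  shows "coincide R (min \<delta> \<delta>') (min \<delta> \<delta>') W W'"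
  using assms unfolding coincide_def straight_shadow_wave_def Let_def
  by (simp add: min_le_iff_disj)

lemma physical_solution_is_straight:
  assumes "0 < R" "0 < \<rho>l" "0 < \<rho>r" "ur < ul"
    and W: "local_shadow_wave_solution n R W"
    and init: "has_initial_data R (pseudo_riemann_data n R \<rho>l ul \<rho>r ur) W"
    and phys: "physical W"
  shows "\<exists>\<delta>>0. straight_shadow_wave n R \<rho>l ul \<rho>r ur \<delta> W"
proof -
  define s0 where "s0 = shock_speed \<rho>l ul \<rho>r ur"
  define T c v \<sigma> where "T = lifetime W" and "c = front W" and "v = speed W" and "\<sigma> = mass W"
  note abbr = T_def[symmetric] c_def[symmetric] v_def[symmetric] \<sigma>_def[symmetric]
  have "0 < T" "c 0 = 0" and pos: "\<And>t. t \<in> {0..<T} \<Longrightarrow> 0 < R + c t"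
    and \<sigma>1: "C1_on \<sigma> {0..<T}" and v1: "C1_on v {0..<T}"
    and c: "\<And>t. t \<in> {0..<T} \<Longrightarrow> (c has_real_derivative v t) (at t within {0..<T})"
    and bal: "\<And>t. t \<in> {0..<T} \<Longrightarrow> vector_derivative \<sigma> (at t within {0..<T})
          + (real n - 1) / (R + c t) * (\<sigma> t * v t) = kappa1 R W t"
        "\<And>t. t \<in> {0..<T} \<Longrightarrow> vector_derivative (\<lambda>s. \<sigma> s * v s) (at t within {0..<T})
          + (real n - 1) / (R + c t) * (\<sigma> t * (v t)\<^sup>2) = kappa2 R W t"
    using W unfolding local_shadow_wave_solution_def abbr by auto
  have left: "left_region R W = side_region (- 1) R T c"
    unfolding T_def c_def by (rule left_region_eq_side_region)
  have right: "right_region R W = side_region 1 R T c"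
    unfolding T_def c_def by (rule right_region_eq_side_region) (use pos in \<open>auto simp: T_def c_def\<close>)
  have reg0: "C1_on (rho0 W) (side_region (- 1) R T c)" "C1_on (u0 W) (side_region (- 1) R T c)"
      "solves_system n (rho0 W) (u0 W) (interior (side_region (- 1) R T c))"
    and reg1: "C1_on (rho1 W) (side_region 1 R T c)" "C1_on (u1 W) (side_region 1 R T c)"
      "solves_system n (rho1 W) (u1 W) (interior (side_region 1 R T c))"
    using W unfolding local_shadow_wave_solution_def left right by auto
  have "\<sigma> 0 = 0"
    and init0: "\<And>r. 0 < r \<Longrightarrow> 0 < - 1 * (r - R) \<Longrightarrow> rho0 W (r, 0) = \<rho>l * r powr (1 - real n) \<and> u0 W (r, 0) = ul"
    and init1: "\<And>r. 0 < r \<Longrightarrow> 0 < 1 * (r - R) \<Longrightarrow> rho1 W (r, 0) = \<rho>r * r powr (1 - real n) \<and> u1 W (r, 0) = ur"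
    using init unfolding has_initial_data_def \<sigma>_def by (auto simp: pseudo_riemann_data_def)
  have "0 \<le> \<sigma> t" if "t \<in> {0..<T}" for t
    using phys that by (auto simp: physical_def \<sigma>_def T_def)

  note \<sigma>' = C1_on_has_vector_derivative[OF \<sigma>1, folded has_real_derivative_iff_has_vector_derivative]
  note v' = C1_on_has_vector_derivative[OF v1, folded has_real_derivative_iff_has_vector_derivative]
  have fd: "front_derivative W t = v t" if "t \<in> {0..<T}" for t
    using c[OF that] at_within_atLeastLessThan_neq_bot[OF that]
    by (simp add: front_derivative_def abbr vector_derivative_within has_real_derivative_iff_has_vector_derivative)
  have D\<sigma>: "(\<sigma> has_real_derivative kappa1 R W t - (real n - 1) / (R + c t) * (\<sigma> t * v t)) (at t within {0..<T})"
    if "t \<in> {0..<T}" for t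
    using \<sigma>'[OF that] unfolding eq_diff_eq[THEN iffD2, OF bal(1)[OF that]] .
  have D\<sigma>v: "((\<lambda>t. \<sigma> t * v t) has_real_derivative
      kappa2 R W t - (real n - 1) / (R + c t) * (\<sigma> t * (v t)\<^sup>2)) (at t within {0..<T})"
    if "t \<in> {0..<T}" for t
  proof -
    have "((\<lambda>t. \<sigma> t * v t) has_vector_derivative vector_derivative (\<lambda>t. \<sigma> t * v t) (at t within {0..<T}))
        (at t within {0..<T})"
      using DERIV_mult[OF \<sigma>'[OF that] v'[OF that]]
      by (metis has_real_derivative_iff_has_vector_derivative vector_derivative_within
          at_within_atLeastLessThan_neq_bot[OF that])
    then show ?thesis
      unfolding eq_diff_eq[THEN iffD2, OF bal(2)[OF that]] has_real_derivative_iff_has_vector_derivative .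
  qed

  \<comment> \<open>Both outer densities carry the same power of the front position, which factors
    out and leaves jumps of constants.\<close>
  have kappa: "kappa1 R W t = (R + c t) powr (1 - real n) * (v t * (\<rho>r - \<rho>l) - (\<rho>r * ur - \<rho>l * ul))"
    "kappa2 R W t = (R + c t) powr (1 - real n) * (v t * (\<rho>r * ur - \<rho>l * ul) - (\<rho>r * ur\<^sup>2 - \<rho>l * ul\<^sup>2))"
    if "t \<in> {0..<T}"
      "rho0 W (R + c t, t) = \<rho>l * (R + c t) powr (1 - real n) \<and> u0 W (R + c t, t) = ul"
      "rho1 W (R + c t, t) = \<rho>r * (R + c t) powr (1 - real n) \<and> u1 W (R + c t, t) = ur" for t
    using that fd[OF that(1)]
    by (simp_all add: kappa1_def kappa2_def jump_def Let_def abbr algebra_simps)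

  \<comment> \<open>Bounds on the initial speed\<close>
  have T0: "0 \<in> {0..<T}"
    using \<open>0 < T\<close> by simp
  have trace: "rho0 W (R, 0) = \<rho>l * R powr (1 - real n)" "u0 W (R, 0) = ul"
    "rho1 W (R, 0) = \<rho>r * R powr (1 - real n)" "u1 W (R, 0) = ur"
    using \<open>0 < R\<close> \<open>0 < T\<close> \<open>c 0 = 0\<close> init0 init1
    by (auto intro!: continuous_intros
        side_region_trace[OF C1_on_imp_continuous_on[OF reg0(1)], where g="\<lambda>r. \<rho>l * r powr (1 - real n)"]
        side_region_trace[OF C1_on_imp_continuous_on[OF reg0(2)], where g="\<lambda>_. ul"]
        side_region_trace[OF C1_on_imp_continuous_on[OF reg1(1)], where g="\<lambda>r. \<rho>r * r powr (1 - real n)"]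
        side_region_trace[OF C1_on_imp_continuous_on[OF reg1(2)], where g="\<lambda>_. ur"])
  note kappa0 = kappa[OF T0, unfolded \<open>c 0 = 0\<close> add_0_right, OF conjI[OF trace(1,2)] conjI[OF trace(3,4)]]
  have D\<sigma>0: "(\<sigma> has_real_derivative kappa1 R W 0) (at 0 within {0..<T})"
    using D\<sigma>[OF T0] by (simp add: \<open>\<sigma> 0 = 0\<close>)
  \<comment> \<open>Since \<open>\<sigma> 0 = 0\<close>, the value \<open>kappa1 R W 0\<close> is
    the right derivative of \<open>\<sigma>\<close> at 0, a limit of nonnegative quotients.\<close>
  have "0 \<le> kappa1 R W 0"
  proof (rule tendsto_lowerbound)
    show "((\<lambda>h. (\<sigma> h - \<sigma> 0) / (h - 0)) \<longlongrightarrow> kappa1 R W 0) (at 0 within {0..<T})"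
      using D\<sigma>0 by (simp add: has_field_derivative_iff)
    show "\<forall>\<^sub>F h in at 0 within {0..<T}. 0 \<le> (\<sigma> h - \<sigma> 0) / (h - 0)"
      using \<open>\<And>t. t \<in> {0..<T} \<Longrightarrow> 0 \<le> \<sigma> t\<close>
      by (auto simp: eventually_at \<open>\<sigma> 0 = 0\<close> intro!: exI[of _ 1] divide_nonneg_nonneg)
  qed (rule at_within_atLeastLessThan_neq_bot[OF T0])
  \<comment> \<open>At time 0 the terms containing \<open>\<sigma> 0\<close> vanish, both in the
    product rule and in the momentum balance.\<close>
  moreover have "kappa2 R W 0 = kappa1 R W 0 * v 0"
  proof -
    have "((\<lambda>t. \<sigma> t * v t) has_real_derivative kappa1 R W 0 * v 0) (at 0 within {0..<T})"
      using DERIV_mult[OF D\<sigma>0 v'[OF T0]] by (simp add: \<open>\<sigma> 0 = 0\<close>)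
    then show ?thesis
      using D\<sigma>v[OF T0] vector_derivative_unique_within[OF at_within_atLeastLessThan_neq_bot[OF T0]]
      by (simp add: \<open>\<sigma> 0 = 0\<close> has_real_derivative_iff_has_vector_derivative)
  qed
  moreover have Rn: "0 < R powr (1 - real n)"
    using \<open>0 < R\<close> by simp
  ultimately have "0 \<le> v 0 * (\<rho>r - \<rho>l) - (\<rho>r * ur - \<rho>l * ul)"
    "v 0 * (\<rho>r * ur - \<rho>l * ul) - (\<rho>r * ur\<^sup>2 - \<rho>l * ul\<^sup>2) = (v 0 * (\<rho>r - \<rho>l) - (\<rho>r * ur - \<rho>l * ul)) * v 0"
    unfolding kappa0 by (auto simp: zero_le_mult_iff)
  \<comment> \<open>Rearranged, the second relation is
    \<open>\<rho>r * (v 0 - ur)\<^sup>2 = \<rho>l * (v 0 - ul)\<^sup>2\<close>.\<close>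
  then have v0: "ur < v 0" "v 0 < ul"
    using overcompressive_speed[OF \<open>0 < \<rho>l\<close> \<open>0 < \<rho>r\<close> \<open>ur < ul\<close>, of "v 0"]
    by (simp_all add: algebra_simps power2_eq_square)

  \<comment> \<open>Explicit outer states for small times\<close>
  note vc = C1_on_imp_continuous_on[OF v1]
  \<comment> \<open>The bounds \<open>v0\<close> are the sign condition of
    \<open>outer_state_near_front\<close>, with \<open>s = -1\<close> here and \<open>s = 1\<close>
    on the right.\<close>
  obtain \<delta>0 where "0 < \<delta>0" and \<delta>0: "\<And>r t. (r, t) \<in> side_region (- 1) R T c \<Longrightarrow> \<bar>r - R\<bar> < \<delta>0 \<Longrightarrow> t < \<delta>0 \<Longrightarrow>
      rho0 W (r, t) = \<rho>l * r powr (1 - real n) \<and> u0 W (r, t) = ul"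
    using outer_state_near_front[OF c vc \<open>c 0 = 0\<close> \<open>0 < R\<close> \<open>0 < T\<close> _ _ reg0 \<open>0 < \<rho>l\<close> init0] v0 by auto
  obtain \<delta>1 where "0 < \<delta>1" and \<delta>1: "\<And>r t. (r, t) \<in> side_region 1 R T c \<Longrightarrow> \<bar>r - R\<bar> < \<delta>1 \<Longrightarrow> t < \<delta>1 \<Longrightarrow>
      rho1 W (r, t) = \<rho>r * r powr (1 - real n) \<and> u1 W (r, t) = ur"
    using outer_state_near_front[OF c vc \<open>c 0 = 0\<close> \<open>0 < R\<close> \<open>0 < T\<close> _ _ reg1 \<open>0 < \<rho>r\<close> init1] v0 by auto
  have cc: "continuous_on {0..<T} c"
    using c by (intro DERIV_continuous_on) auto
  have "\<forall>\<^sub>F t in at 0 within {0..<T}. \<bar>c t\<bar> < min \<delta>0 \<delta>1"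
  proof -
    have "(c \<longlongrightarrow> 0) (at 0 within {0..<T})"
      using cc T0 \<open>c 0 = 0\<close> unfolding continuous_on_def by metis
    then show ?thesis
      using tendstoD[of c 0 _ "min \<delta>0 \<delta>1"] \<open>0 < \<delta>0\<close> \<open>0 < \<delta>1\<close> by (simp add: dist_real_def)
  qed
  moreover have "\<forall>\<^sub>F t in at 0 within {0..<T}. ur < v t" "\<forall>\<^sub>F t in at 0 within {0..<T}. v t < ul"
    using vc T0 v0 by (auto simp: continuous_on_def intro: order_tendstoD)
  ultimately have "\<forall>\<^sub>F t in at 0 within {0..<T}. \<bar>c t\<bar> < min \<delta>0 \<delta>1 \<and> ur < v t \<and> v t < ul"
    by eventually_elim auto
  \<comment> \<open>The limit filter leaves out \<open>t = 0\<close>; there the bounds follow from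
    \<open>c 0 = 0\<close> and \<open>v0\<close>.\<close>
  then obtain d where "0 < d" and
    d: "\<And>t. t \<in> {0..<T} \<Longrightarrow> t < d \<Longrightarrow> \<bar>c t\<bar> < min \<delta>0 \<delta>1 \<and> ur < v t \<and> v t < ul"
    unfolding eventually_at using v0 \<open>c 0 = 0\<close> \<open>0 < \<delta>0\<close> \<open>0 < \<delta>1\<close>
    by (metis abs_of_nonneg abs_zero atLeastLessThan_iff diff_zero dist_real_def min_less_iff_conj)
  define \<delta> where "\<delta> = min (min T d) (min \<delta>0 \<delta>1)"
  have "0 < \<delta>"
    using \<open>0 < T\<close> \<open>0 < d\<close> \<open>0 < \<delta>0\<close> \<open>0 < \<delta>1\<close> by (simp add: \<delta>_def)
  have subset: "{0..<\<delta>} \<subseteq> {0..<T}"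
    by (auto simp: \<delta>_def)
  note sub = subsetD[OF subset]

  \<comment> \<open>Integration of the weighted front equations\<close>
  define m where "m = (\<lambda>t. (R + c t) powr (real n - 1) * \<sigma> t)"
  \<comment> \<open>The weight is an integrating factor: its derivative cancels the geometric term.
    It is applied to \<open>\<sigma>\<close> for the mass and to \<open>\<sigma> t * v t\<close> for
    the momentum.\<close>
  have D_weight: "((\<lambda>t. (R + c t) powr (real n - 1) * f t) has_real_derivative K) (at t within {0..<\<delta>})"
    if f: "(f has_real_derivative (R + c t) powr (1 - real n) * K - (real n - 1) / (R + c t) * (f t * v t))
        (at t within {0..<T})" and t: "t \<in> {0..<\<delta>}" for f K t
  proof -
    have p: "0 < R + c t"
      using pos sub t by blast
    have "((\<lambda>t. (R + c t) powr (real n - 1)) has_real_derivative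
        (real n - 1) / (R + c t) * (R + c t) powr (real n - 1) * v t) (at t within {0..<T})"
      using c[OF sub[OF t]] p
      by (intro has_real_derivative_powr_chain) (auto intro!: derivative_eq_intros)
    from DERIV_mult[OF this f]
    have "((\<lambda>t. (R + c t) powr (real n - 1) * f t) has_real_derivative
        ((R + c t) powr (real n - 1) * (R + c t) powr (1 - real n)) * K) (at t within {0..<T})"
      by (rule back_subst[where P="\<lambda>D. (_ has_real_derivative D) _"]) (simp add: algebra_simps)
    then have "((\<lambda>t. (R + c t) powr (real n - 1) * f t) has_real_derivative K) (at t within {0..<T})"
      using p by (simp flip: powr_add)
    then show ?thesis
      by (rule DERIV_subset[OF _ subset])
  qed
  have front_states: "rho0 W (R + c t, t) = \<rho>l * (R + c t) powr (1 - real n) \<and> u0 W (R + c t, t) = ul"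
    "rho1 W (R + c t, t) = \<rho>r * (R + c t) powr (1 - real n) \<and> u1 W (R + c t, t) = ur" if "t \<in> {0..<\<delta>}" for t
    using that pos[OF sub[OF that]] d[of t] \<delta>0[of "R + c t" t] \<delta>1[of "R + c t" t]
    by (auto simp: side_region_def \<delta>_def)
  have line: "c t = s0 * t" "v t = s0" "m t = ((\<rho>r - \<rho>l) * s0 - (\<rho>r * ur - \<rho>l * ul)) * t" if t: "t \<in> {0..<\<delta>}" for t
  proof -
    have Dc: "(c has_real_derivative v t) (at t within {0..<\<delta>})" if "t \<in> {0..<\<delta>}" for t
      by (rule DERIV_subset[OF c[OF sub[OF that]] subset])
    have Dm: "(m has_real_derivative v t * (\<rho>r - \<rho>l) - (\<rho>r * ur - \<rho>l * ul)) (at t within {0..<\<delta>})"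
      if "t \<in> {0..<\<delta>}" for t
      unfolding m_def using D\<sigma>[OF sub[OF that]] kappa(1)[OF sub[OF that] front_states[OF that]]
      by (intro D_weight that) simp
    have Dmv: "((\<lambda>t. m t * v t) has_real_derivative
        v t * (\<rho>r * ur - \<rho>l * ul) - (\<rho>r * ur\<^sup>2 - \<rho>l * ul\<^sup>2)) (at t within {0..<\<delta>})"
      if "t \<in> {0..<\<delta>}" for t
      unfolding m_def mult.assoc using D\<sigma>v[OF sub[OF that]] kappa(2)[OF sub[OF that] front_states[OF that]]
      by (intro D_weight that) (simp add: power2_eq_square mult.assoc)
    have vb: "ur < v t \<and> v t < ul" if "t \<in> {0..<\<delta>}" for t
      using d[OF sub[OF that]] that by (simp add: \<delta>_def)
    have "m 0 = 0"
      by (simp add: m_def \<open>\<sigma> 0 = 0\<close>)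
    note fl = front_line[OF \<open>0 < \<rho>l\<close> \<open>0 < \<rho>r\<close> Dc Dm Dmv \<open>c 0 = 0\<close> \<open>m 0 = 0\<close> vb t, folded s0_def]
    show "c t = s0 * t" "v t = s0" "m t = ((\<rho>r - \<rho>l) * s0 - (\<rho>r * ur - \<rho>l * ul)) * t"
      using fl by blast+
  qed
  have "straight_shadow_wave n R \<rho>l ul \<rho>r ur \<delta> W"
    unfolding straight_shadow_wave_def Let_def s0_def[symmetric] abbr
  proof (intro conjI ballI allI impI)
    show "\<delta> \<le> T"
      by (simp add: \<delta>_def)
    fix t assume t: "t \<in> {0..<\<delta>}"
    show "c t = s0 * t" "v t = s0"
      using line[OF t] by simp_all
    have "m t * (R + c t) powr (1 - real n) = \<sigma> t * ((R + c t) powr (real n - 1) * (R + c t) powr (1 - real n))"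
      by (simp add: m_def)
    also have "\<dots> = \<sigma> t"
      using pos[OF sub[OF t]] by (simp flip: powr_add)
    finally show "\<sigma> t = ((\<rho>r - \<rho>l) * s0 - (\<rho>r * ur - \<rho>l * ul)) * t * (R + s0 * t) powr (1 - real n)"
      unfolding line[OF t] by simp
    fix r
    show "rho0 W (r, t) = \<rho>l * r powr (1 - real n)" "u0 W (r, t) = ul"
      if "\<bar>r - R\<bar> < \<delta> \<and> 0 < r \<and> r \<le> R + c t"
      using that t \<delta>0[of r t] by (auto simp: side_region_def \<delta>_def)
    show "rho1 W (r, t) = \<rho>r * r powr (1 - real n)" "u1 W (r, t) = ur"
      if "\<bar>r - R\<bar> < \<delta> \<and> R + c t \<le> r"
      using that t pos[OF sub[OF t]] \<delta>1[of r t] by (auto simp: side_region_def \<delta>_def)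
  qed
  then show ?thesis
    using \<open>0 < \<delta>\<close> by blast
qed

theorem corollary6p2:
  fixes n :: nat and R \<rho>l \<rho>r ul ur :: real and W W' :: shadow_wave
  assumes "1 \<le> n" and "0 < R" and "0 < \<rho>l" and "0 < \<rho>r" and "ur < ul"
    and "local_shadow_wave_solution n R W"
    and "has_initial_data R (pseudo_riemann_data n R \<rho>l ul \<rho>r ur) W"
    and "physical W" and "dissipative n R W"
    and "local_shadow_wave_solution n R W'"
    and "has_initial_data R (pseudo_riemann_data n R \<rho>l ul \<rho>r ur) W'"
    and "physical W'" and "dissipative n R W'"
  shows "\<exists>\<delta>>0. \<exists>T0>0. coincide R \<delta> T0 W W'"
proof -
  obtain \<delta> \<delta>' where "0 < \<delta>" "straight_shadow_wave n R \<rho>l ul \<rho>r ur \<delta> W"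
    and "0 < \<delta>'" "straight_shadow_wave n R \<rho>l ul \<rho>r ur \<delta>' W'"
    using physical_solution_is_straight[OF assms(2-8)] physical_solution_is_straight[OF assms(2-5,10-12)]
    by blast
  then show ?thesis
    using straight_shadow_waves_coincide by (metis min_less_iff_conj)
qed

end
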